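(* Let $m$ be a positive integer, let $n\in\{2m,2m+1\}$, and let $F(x)=x^{2^{m+1}-1}$ be the power mapping on $\mathbb{F}_{2^n}$. Let $a,b\in\mathbb{F}_{2^n}$. Then: (i) if $n=2m$, then $$\mathrm{FBCT}_F(a,b)=\begin{cases}2^n,&\text{if }ab(a+b)=0;\\ 2^m,&\text{if }ab(a+b)\neq 0\text{ and }\frac{a}{b}\in\mathbb{F}_{2^m}\setminus\{0,1\};\\ 0,&\text{if }ab(a+b)\neq 0\text{ and }\frac{a}{b}\in\mathbb{F}_{2^n}\setminus\mathbb{F}_{2^m};\end{cases}$$ (ii) if $n=2m+1$, then $$\mathrm{FBCT}_F(a,b)=\begin{cases}2^n,&\text{if }ab(a+b)=0;\\ 0,&\text{if }ab(a+b)\neq 0.\end{cases}$$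
   Context: $\mathbb{F}_{2^n}$ is the finite field with $2^n$ elements; when $n=2m$, $\mathbb{F}_{2^m}$ is regarded as its subfield of order $2^m$. For a mapping $F:\mathbb{F}_{2^n}\to\mathbb{F}_{2^n}$ and $(a,b)\in\mathbb{F}_{2^n}^2$, the Feistel Boomerang Connectivity Table (FBCT) entry is $$\mathrm{FBCT}_F(a,b)=|\{x\in\mathbb{F}_{2^n}:F(x)+F(x+a)+F(x+b)+F(x+a+b)=0\}|.$$ *)

theory Defs
  imports "HOL-Algebra.Algebraic_Closure_Type" "HOL-Number_Theory.Residues"
begin

definition FBCT :: "('a::finite_field \<Rightarrow> 'a) \<Rightarrow> 'a \<Rightarrow> 'a \<Rightarrow> nat" where
  "FBCT F a b = card {x. F x + F (x + a) + F (x + b) + F (x + a + b) = 0}"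

(* Meaningful only when exactly one such subfield exists, as in ex1_subfield_of_order. *)
definition subfield_of_order :: "nat \<Rightarrow> 'a::finite_field set" where
  "subfield_of_order q = (THE K. subfield K (ring_of_type_algebra :: 'a ring) \<and> card K = q)"

context
  fixes R :: "'a::finite_field ring"
  defines "R \<equiv> ring_of_type_algebra"
begin

lemma type_ring_simps:
  "carrier R = UNIV" "x \<otimes>\<^bsub>R\<^esub> y = x * y" "x \<oplus>\<^bsub>R\<^esub> y = x + y" "\<one>\<^bsub>R\<^esub> = 1" "\<zero>\<^bsub>R\<^esub> = 0"
  by (simp_all add: R_def ring_of_type_algebra_def)

lemma type_ring_field: "field R"
  unfolding R_def by (rule field_from_type_algebra)

lemma type_ring_uminus: "\<ominus>\<^bsub>R\<^esub> x = - x"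
proof -
  interpret field R by (rule type_ring_field)
  show ?thesis using minus_equality[of "-x" x] by (simp add: type_ring_simps)
qed

lemma type_ring_inv: "x \<noteq> 0 \<Longrightarrow> inv\<^bsub>R\<^esub> x = inverse x"
proof -
  interpret field R by (rule type_ring_field)
  show "x \<noteq> 0 \<Longrightarrow> ?thesis" using comm_inv_char[of x "inverse x"] by (simp add: type_ring_simps)
qed

lemma subfield_type_iff:
  "subfield K R \<longleftrightarrow>
     0 \<in> K \<and> 1 \<in> K \<and> (\<forall>x\<in>K. \<forall>y\<in>K. x + y \<in> K \<and> x * y \<in> K) \<and> (\<forall>x\<in>K. - x \<in> K \<and> inverse x \<in> K)"
  (is "_ \<longleftrightarrow> ?P")
proof
  interpret field R by (rule type_ring_field)
  assume K: "subfield K R"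
  note sr = subringE[OF subfieldE(1)[OF K], unfolded type_ring_simps type_ring_uminus]
  have "inverse x \<in> K" if "x \<in> K" for x
    using subfield_m_inv(1)[OF K, of x] sr(2) that type_ring_inv[of x] by (cases "x = 0") (auto simp: type_ring_simps)
  then show ?P
    by (intro conjI ballI sr)
next
  interpret field R by (rule type_ring_field)
  assume P: ?P
  show "subfield K R"
  proof (rule subfieldI')
    show "subring K R"
      by (rule subringI; unfold type_ring_simps type_ring_uminus) (use P in \<open>blast+\<close>)
    show "inv\<^bsub>R\<^esub> k \<in> K" if "k \<in> K - {\<zero>\<^bsub>R\<^esub>}" for k
      using P that type_ring_inv[of k] unfolding type_ring_simps by (metis DiffE singletonI)
  qed
qed

end

lemma subfield_power_card:
  fixes K :: "'a::finite_field set"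
  assumes K: "subfield K (ring_of_type_algebra :: 'a ring)" and x: "x \<in> K"
  shows "x ^ card K = x"
proof (cases "x = 0")
  case False
  note K' = K[unfolded subfield_type_iff]
  have "(\<Prod>y\<in>K-{0}. x * y) = x ^ card (K - {0}) * \<Prod>(K-{0})"
    by (simp add: prod.distrib)
  moreover have "(\<Prod>y\<in>K-{0}. x * y) = (\<Prod>y\<in>K-{0}. y)"
    by (rule prod.reindex_bij_witness[of _ "\<lambda>y. y / x" "\<lambda>y. x * y"])
       (use False K' x in \<open>auto simp: divide_inverse\<close>)
  moreover have "\<Prod>(K-{0}) \<noteq> 0"
    by simp
  ultimately have "x ^ card (K - {0}) = 1"
    by (metis mult_cancel_right1)
  moreover have "card K = Suc (card (K - {0}))"
    using K' by (intro card.remove) auto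
  ultimately show ?thesis by (metis power_Suc mult.right_neutral)
next
  case True
  then show ?thesis using x by (auto simp: power_0_left card_eq_0_iff)
qed

lemma CHAR_eq_2:
  assumes "card (UNIV :: 'a::finite_field set) = 2 ^ n"
  shows "CHAR('a) = 2"
proof -
  have "CHAR('a) dvd 2 ^ n" using CHAR_dvd_CARD[where ?'a='a] assms by simp
  moreover have "prime CHAR('a)" by simp
  ultimately have "CHAR('a) dvd 2" using prime_dvd_power by blast
  then show ?thesis using \<open>prime CHAR('a)\<close> by (metis primes_dvd_imp_eq two_is_prime_nat)
qed

lemma uminus_eq_self:
  fixes x :: "'a::finite_field"
  assumes "CHAR('a) = 2"
  shows "- x = x"
proof -
  have "of_nat 2 = (0::'a)" using of_nat_CHAR[where ?'a='a] assms by simp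
  then have "x + x = 0" by (metis mult_2 mult_zero_left of_nat_numeral)
  then show ?thesis by (metis neg_eq_iff_add_eq_0)
qed

lemma card_frobenius_fixed_le:
  assumes "q > 1"
  shows "card {x::'a::finite_field. x ^ q = x} \<le> q"
proof -
  let ?p = "Polynomial.monom (1::'a) q - Polynomial.monom 1 1"
  have "Polynomial.coeff ?p q = 1" using assms by simp
  then have "?p \<noteq> 0" by (metis Polynomial.coeff_0 zero_neq_one)
  then have "card {x. poly ?p x = 0} \<le> Polynomial.degree ?p" by (rule card_poly_roots_bound)
  also have "\<dots> \<le> q" using assms by (intro degree_diff_le) (auto intro: order_trans[OF degree_monom_le])
  finally show ?thesis by (simp add: poly_monom)
qed

lemma card_frobenius_fixed:
  assumes "card (UNIV :: 'a::finite_field set) = 2 ^ (2 * m)" "m > 0"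
  shows "card {x::'a. x ^ 2 ^ m = x} = 2 ^ m"
proof (rule antisym)
  define q :: nat where "q = 2 ^ m"
  define T where "T = (\<lambda>x::'a. x ^ q - x)"
  define S where "S = {x::'a. x ^ q = x}"
  have ch: "CHAR('a) = 2" using assms(1) by (rule CHAR_eq_2)
  have q1: "q > 1" using assms(2) one_less_power[of "2::nat" m] by (simp add: q_def)
  have uc: "card (UNIV::'a set) = q * q" by (simp add: assms q_def mult_2 power_add)
  have frob: "(x + y) ^ q = x ^ q + y ^ q" for x y :: 'a
    by (rule freshmans_dream'[where n = m]) (simp_all add: ch q_def)
  have neg: "- x = x" for x :: 'a using ch by (rule uminus_eq_self)
  show "card {x::'a. x ^ 2 ^ m = x} \<le> 2 ^ m"
    using card_frobenius_fixed_le[OF q1] by (simp add: q_def)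
  have diff: "x - y = x + y" for x y :: 'a using neg[of y] by (metis diff_conv_add_uminus)
  have TS: "T x \<in> S" for x
  proof -
    have "(x ^ q) ^ q = x"
      using finite_field_power_card_eq_same[of x] by (simp add: uc power_mult)
    then show ?thesis by (simp add: T_def S_def diff frob add.commute)
  qed
  have fib: "card {x. T x = y} \<le> card S" for y
  proof (cases "\<exists>z. T z = y")
    case True
    then obtain z where z: "T z = y" by blast
    have "(\<lambda>x. x - z) ` {x. T x = y} \<subseteq> S"
    proof clarify
      fix x assume "y = T x"
      then have "x ^ q - x = z ^ q - z" using z by (simp add: T_def)
      then have "x ^ q - z ^ q = x - z" by (simp add: algebra_simps)
      moreover have "(x - z) ^ q = x ^ q - z ^ q" by (simp add: diff frob)
      ultimately show "x - z \<in> S" by (simp add: S_def)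
    qed
    moreover have "inj_on (\<lambda>x. x - z) {x. T x = y}" by (simp add: inj_on_def)
    ultimately show ?thesis by (meson card_inj_on_le finite)
  next
    case False then show ?thesis by simp
  qed
  have "q * q = card (\<Union>y\<in>S. {x. T x = y})" using TS by (subst uc[symmetric]) (rule arg_cong[of _ _ card], auto)
  also have "\<dots> \<le> (\<Sum>y\<in>S. card {x. T x = y})" by (rule card_UN_le) simp
  also have "\<dots> \<le> (\<Sum>y\<in>S. card S)" by (rule sum_mono) (rule fib)
  finally have "q * q \<le> card S * card S" by simp
  then have "q \<le> card S"
    by (metis linorder_not_less mult_strict_mono' zero_le)
  then show "2 ^ m \<le> card {x::'a. x ^ 2 ^ m = x}" by (simp add: q_def S_def)
qed

lemma ex1_subfield_of_order:
  assumes "card (UNIV :: 'a::finite_field set) = 2 ^ (2 * m)" "m > 0"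
  shows "\<exists>!K. subfield K (ring_of_type_algebra :: 'a ring) \<and> card K = 2 ^ m"
proof (rule ex1I[of _ "{x. x ^ 2 ^ m = x}"])
  have frob: "(x + y) ^ 2 ^ m = x ^ 2 ^ m + y ^ 2 ^ m" for x y :: 'a
    by (rule freshmans_dream'[where n = m]) (simp_all add: CHAR_eq_2[OF assms(1)])
  show "subfield {x. x ^ 2 ^ m = x} (ring_of_type_algebra :: 'a ring) \<and> card {x::'a. x ^ 2 ^ m = x} = 2 ^ m"
    using assms card_frobenius_fixed[OF assms]
    by (auto simp: subfield_type_iff frob power_mult_distrib power_inverse uminus_eq_self[OF CHAR_eq_2[OF assms(1)]])
next
  fix K assume K: "subfield K (ring_of_type_algebra :: 'a ring) \<and> card K = 2 ^ m"
  then have "K \<subseteq> {x. x ^ 2 ^ m = x}" using subfield_power_card[of K] by auto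
  then show "K = {x. x ^ 2 ^ m = x}" using K card_frobenius_fixed[OF assms] by (intro card_subset_eq) auto
qed

lemma subfield_of_order_props:
  assumes "card (UNIV :: 'a::finite_field set) = 2 ^ (2 * m)" "m > 0"
  shows "subfield (subfield_of_order (2 ^ m)) (ring_of_type_algebra :: 'a ring)"
    and "card (subfield_of_order (2 ^ m) :: 'a set) = 2 ^ m"
  using theI'[OF ex1_subfield_of_order[OF assms]] by (auto simp: subfield_of_order_def)

end

theory Submission
  imports Defs
begin

text \<open>
  Put \<open>q = 2 ^ m\<close> and \<open>\<sigma> x = x ^ (2 * q)\<close>, an additive map with \<open>x * F x = \<sigma> x\<close>. Since \<open>F\<close> is
  multiplicative, \<open>b\<close> may be scaled to 1 and \<open>a\<close> to \<open>t = a / b\<close>. Clearing denominators turns the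
  equation for \<open>x\<close> outside \<open>V = {0, 1, t, t + 1}\<close> into the linearized equation
  \<open>(t\<^sup>2 + t) * \<sigma> x + (\<sigma> t + t) * x\<^sup>2 + (\<sigma> t + t\<^sup>2) * x = 0\<close>,
  while the points of \<open>V\<close> are solutions iff \<open>\<sigma> t = t\<^sup>2\<close>, that is, \<open>t ^ q = t\<close>. In that case, which for
  \<open>n = 2 * m + 1\<close> is excluded, the equation becomes \<open>x ^ q = x\<close>. Otherwise, combining the equation
  with its image under \<open>x \<mapsto> x ^ q\<close> (for \<open>n = 2 * m\<close>) or under \<open>\<sigma>\<close> (for \<open>n = 2 * m + 1\<close>) confines
  its solutions to \<open>V\<close>, so that none remain.
\<close>

section \<open>Arithmetic in characteristic 2\<close>

text \<open>Rewrite rules that, together with \<open>algebra_simps\<close>, settle polynomial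
  identities modulo 2: equal monomials cancel in sorted sums, and the numerals cover like terms
  collected into a coefficient.\<close>

lemma char2_simps:
  fixes x y :: "'a::finite_field"
  assumes "CHAR('a) = 2"
  shows "x + x = 0" "x + (x + y) = y" "- x = x" "x - y = x + y" "(2::'a) = 0" "(3::'a) = 1" "(4::'a) = 0"
proof -
  show *: "x + x = 0" for x :: 'a
    using uminus_eq_self[OF assms, of x] by (metis add.right_inverse)
  show "x + (x + y) = y" by (simp add: * flip: add.assoc)
  show "- x = x" by (rule uminus_eq_self[OF assms])
  show "x - y = x + y" by (metis diff_conv_add_uminus uminus_eq_self[OF assms])
  show 2: "(2::'a) = 0" using *[of 1] by simp
  have "(3::'a) = 2 + 1" "(4::'a) = 2 + 2" by simp_all
  then show "(3::'a) = 1" "(4::'a) = 0" unfolding 2 by simp_all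
qed

lemma char2_add_eq_0_iff:
  fixes x y :: "'a::finite_field"
  assumes "CHAR('a) = 2"
  shows "x + y = 0 \<longleftrightarrow> x = y"
  by (metis assms add_eq_0_iff uminus_eq_self)

lemma char2_power2_eq_iff:
  fixes x y :: "'a::finite_field"
  assumes "CHAR('a) = 2"
  shows "x\<^sup>2 = y\<^sup>2 \<longleftrightarrow> x = y"
  using power2_eq_iff[of x y] uminus_eq_self[OF assms, of y] by auto

lemma char2_power_add:
  fixes x y :: "'a::finite_field"
  assumes "CHAR('a) = 2"
  shows "(x + y) ^ 2 ^ m = x ^ 2 ^ m + y ^ 2 ^ m"
  by (rule freshmans_dream'[where n = m]) (simp_all add: assms)

section \<open>Second differences and their reduction to a linearized equation\<close>

text \<open>The second-order derivative of \<open>F\<close> in the directions \<open>a\<close> and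
  \<open>b\<close>, whose zeros \<open>FBCT\<close> counts.\<close>

definition second_difference :: "('a::finite_field \<Rightarrow> 'a) \<Rightarrow> 'a \<Rightarrow> 'a \<Rightarrow> 'a \<Rightarrow> 'a" where
  "second_difference F a b x = F x + F (x + a) + F (x + b) + F (x + a + b)"

text \<open>In each of the cases \<open>a = 0\<close>, \<open>b = 0\<close> and \<open>a = b\<close>
  the four arguments coincide in pairs, so the sum vanishes at every \<open>x\<close>.\<close>

lemma FBCT_trivial:
  fixes F :: "'a::finite_field \<Rightarrow> 'a"
  assumes ch: "CHAR('a) = 2" and "a * b * (a + b) = 0"
  shows "FBCT F a b = card (UNIV :: 'a set)"
proof -
  have "a = 0 \<or> b = 0 \<or> a = b" using assms by (auto simp: char2_add_eq_0_iff)
  then have "F x + F (x + a) + F (x + b) + F (x + a + b) = 0" for x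
    by (auto simp: char2_simps[OF ch] algebra_simps)
  then show ?thesis by (simp add: FBCT_def)
qed

text \<open>Substituting \<open>b * x\<close> for \<open>x\<close> pulls the nonzero factor
  \<open>b ^ k\<close> out of all four terms.\<close>

lemma FBCT_power_scale:
  fixes a b :: "'a::finite_field"
  assumes "b \<noteq> 0"
  shows "FBCT (\<lambda>x. x ^ k) a b = FBCT (\<lambda>x. x ^ k) (a / b) 1"
  unfolding FBCT_def
proof (rule bij_betw_same_card[of "\<lambda>x. x / b"], rule bij_betwI[where g = "\<lambda>x. b * x"])
  let ?S = "\<lambda>x. x ^ k + (x + a) ^ k + (x + b) ^ k + (x + a + b) ^ k"
  let ?S1 = "\<lambda>x. x ^ k + (x + a / b) ^ k + (x + 1) ^ k + (x + a / b + 1) ^ k"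
  have scale: "b * x + a = b * (x + a / b)" "b * x + b = b * (x + 1)" for x
    using assms by (simp_all add: algebra_simps)
  have *: "?S (b * x) = b ^ k * ?S1 x" for x
    unfolding scale power_mult_distrib by (simp only: distrib_left)
  show "(\<lambda>x. b * x) \<in> {x. ?S1 x = 0} \<rightarrow> {x. ?S x = 0}"
    using * by auto
  show "(\<lambda>x. x / b) \<in> {x. ?S x = 0} \<rightarrow> {x. ?S1 x = 0}"
  proof safe
    fix x assume "?S x = 0"
    then have "b ^ k * ?S1 (x / b) = 0" using *[of "x / b"] assms by simp
    then show "?S1 (x / b) = 0" using assms by simp
  qed
qed (use assms in auto)

text \<open>Each factor of the product turns one value of \<open>F\<close> into a value of the
  additive \<open>\<sigma>\<close>. The product equals
  \<open>x^4 + (t^2 + t + 1) * x^2 + (t^2 + t) * x\<close>; the coefficient of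
  \<open>\<sigma> x\<close> is its derivative, the constant \<open>t^2 + t\<close>.\<close>

lemma second_difference_cleared:
  fixes F \<sigma> :: "'a::finite_field \<Rightarrow> 'a"
  assumes ch: "CHAR('a) = 2"
    and F: "\<And>x. x * F x = \<sigma> x" and add: "\<And>x y. \<sigma> (x + y) = \<sigma> x + \<sigma> y" and "\<sigma> 1 = 1"
  shows "x * (x + t) * (x + 1) * (x + t + 1) * second_difference F t 1 x
    = (t\<^sup>2 + t) * \<sigma> x + (\<sigma> t + t) * x\<^sup>2 + (\<sigma> t + t\<^sup>2) * x"
proof -
  have "x * (x + t) * (x + 1) * (x + t + 1) * second_difference F t 1 x
      = (x + t) * (x + 1) * (x + t + 1) * (x * F x)
      + x * (x + 1) * (x + t + 1) * ((x + t) * F (x + t))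
      + x * (x + t) * (x + t + 1) * ((x + 1) * F (x + 1))
      + x * (x + t) * (x + 1) * ((x + t + 1) * F (x + t + 1))"
    by (simp add: second_difference_def algebra_simps)
  also have "\<dots> = (x + t) * (x + 1) * (x + t + 1) * \<sigma> x
      + x * (x + 1) * (x + t + 1) * (\<sigma> x + \<sigma> t)
      + x * (x + t) * (x + t + 1) * (\<sigma> x + 1)
      + x * (x + t) * (x + 1) * (\<sigma> x + \<sigma> t + 1)"
    by (simp only: F add \<open>\<sigma> 1 = 1\<close>)
  also have "\<dots> = (t\<^sup>2 + t) * \<sigma> x + (\<sigma> t + t) * x\<^sup>2 + (\<sigma> t + t\<^sup>2) * x"
    by (simp add: algebra_simps power2_eq_square char2_simps[OF ch])
  finally show ?thesis .
qed

text \<open>Here the cleared identity only says \<open>0 = 0\<close>. But the four points form an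
  additive group, so the second difference takes the same value at all of them, and multiplying this
  value by \<open>t * (t + 1)\<close> gives \<open>\<sigma> t + t^2\<close>.\<close>

lemma second_difference_zero_on_span:
  fixes F \<sigma> :: "'a::finite_field \<Rightarrow> 'a"
  assumes ch: "CHAR('a) = 2"
    and F: "\<And>x. x * F x = \<sigma> x" and add: "\<And>x y. \<sigma> (x + y) = \<sigma> x + \<sigma> y" and "\<sigma> 1 = 1"
    and "F 0 = 0" and t: "t \<noteq> 0" "t \<noteq> 1" and x: "x \<in> {0, 1, t, t + 1}"
  shows "second_difference F t 1 x = 0 \<longleftrightarrow> \<sigma> t = t\<^sup>2"
proof -
  have F1: "F 1 = 1" using F[of 1] \<open>\<sigma> 1 = 1\<close> by simp
  have "second_difference F t 1 x = F t + 1 + F (t + 1)"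
    using x by (auto simp: second_difference_def F1 \<open>F 0 = 0\<close> char2_simps[OF ch] ac_simps)
  moreover have "t * (t + 1) * (F t + 1 + F (t + 1))
      = (t + 1) * (t * F t) + t * (t + 1) + t * ((t + 1) * F (t + 1))"
    by (simp add: algebra_simps)
  moreover have "\<dots> = \<sigma> t + t\<^sup>2"
    unfolding F add \<open>\<sigma> 1 = 1\<close> by (simp add: algebra_simps power2_eq_square char2_simps[OF ch])
  moreover have "t * (t + 1) \<noteq> 0"
    using t by (simp add: char2_add_eq_0_iff[OF ch])
  ultimately show ?thesis
    by (metis char2_add_eq_0_iff[OF ch] mult_eq_0_iff)
qed

lemma span_iff_product_eq_0:
  fixes x t :: "'a::finite_field"
  assumes "CHAR('a) = 2"
  shows "x \<in> {0, 1, t, t + 1} \<longleftrightarrow> x * (x + t) * (x + 1) * (x + t + 1) = 0"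
  unfolding mult_eq_0_iff add.assoc char2_add_eq_0_iff[OF assms] by blast

text \<open>Away from the four points the factor used for clearing is nonzero, so no information is
  lost.\<close>

lemma second_difference_zero_iff:
  fixes F \<sigma> :: "'a::finite_field \<Rightarrow> 'a"
  assumes ch: "CHAR('a) = 2"
    and F: "\<And>x. x * F x = \<sigma> x" and add: "\<And>x y. \<sigma> (x + y) = \<sigma> x + \<sigma> y" and "\<sigma> 1 = 1"
    and "x \<notin> {0, 1, t, t + 1}"
  shows "second_difference F t 1 x = 0 \<longleftrightarrow>
    (t\<^sup>2 + t) * \<sigma> x + (\<sigma> t + t) * x\<^sup>2 + (\<sigma> t + t\<^sup>2) * x = 0"
  using assms(5)
  unfolding span_iff_product_eq_0[OF ch] mult_eq_0_iff
    second_difference_cleared[OF ch F add \<open>\<sigma> 1 = 1\<close>, symmetric]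
  by blast

section \<open>Roots of the linearized equation\<close>

text \<open>With \<open>s = \<phi> t\<close> and \<open>y = \<phi> x\<close>, the involution
  \<open>\<phi>\<close> swaps \<open>x\<close> with \<open>y\<close> and \<open>t\<close> with
  \<open>s\<close>. Adding the equation to its image makes the coefficients symmetric, and the sum
  factors.\<close>

lemma linearized_roots_even:
  fixes \<phi> :: "'a::finite_field \<Rightarrow> 'a"
  assumes ch: "CHAR('a) = 2"
    and add: "\<And>x y. \<phi> (x + y) = \<phi> x + \<phi> y" and mult: "\<And>x y. \<phi> (x * y) = \<phi> x * \<phi> y"
    and invol: "\<And>x. \<phi> (\<phi> x) = x" and nfix: "\<phi> t \<noteq> t"
    and root: "(t\<^sup>2 + t) * (\<phi> x)\<^sup>2 + ((\<phi> t)\<^sup>2 + t) * x\<^sup>2 + ((\<phi> t)\<^sup>2 + t\<^sup>2) * x = 0"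
  shows "x \<in> {0, 1, t, t + 1}"
proof -
  note c2 = char2_simps[OF ch]
  define s where "s = \<phi> t"
  define y where "y = \<phi> x"
  have st: "s + t \<noteq> 0" using nfix by (simp add: s_def char2_add_eq_0_iff[OF ch])
  have st': "s\<^sup>2 + t\<^sup>2 \<noteq> 0"
    using nfix by (simp add: s_def char2_add_eq_0_iff[OF ch] char2_power2_eq_iff[OF ch])
  have r1: "(t\<^sup>2 + t) * y\<^sup>2 + (s\<^sup>2 + t) * x\<^sup>2 + (s\<^sup>2 + t\<^sup>2) * x = 0"
    using root by (simp add: s_def y_def)
  have "\<phi> 0 = 0" using add[of 0 0] by (simp only: add_0_right add_cancel_right_right)
  have "\<phi> ((t\<^sup>2 + t) * (\<phi> x)\<^sup>2 + ((\<phi> t)\<^sup>2 + t) * x\<^sup>2 + ((\<phi> t)\<^sup>2 + t\<^sup>2) * x) = 0"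
    unfolding root by (rule \<open>\<phi> 0 = 0\<close>)
  then have r2: "(s\<^sup>2 + s) * x\<^sup>2 + (t\<^sup>2 + s) * y\<^sup>2 + (t\<^sup>2 + s\<^sup>2) * y = 0"
    by (simp add: add mult invol power2_eq_square s_def y_def)
  have "(s + t) * ((x + y) * (x + y + (s + t))) =
      ((t\<^sup>2 + t) * y\<^sup>2 + (s\<^sup>2 + t) * x\<^sup>2 + (s\<^sup>2 + t\<^sup>2) * x) +
      ((s\<^sup>2 + s) * x\<^sup>2 + (t\<^sup>2 + s) * y\<^sup>2 + (t\<^sup>2 + s\<^sup>2) * y)"
    by (simp add: algebra_simps power2_eq_square c2)
  also have "\<dots> = 0" by (simp add: r1 r2)
  \<comment> \<open>The two cases say that \<open>\<phi>\<close> fixes \<open>x\<close> or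
    \<open>x + t\<close>; the equation then forces that element to be 0 or 1.\<close>
  finally consider "x + y = 0" | "x + y + (s + t) = 0" using st by auto
  then show ?thesis
  proof cases
    case 1
    then have "y = x" by (simp add: char2_add_eq_0_iff[OF ch])
    have "(s\<^sup>2 + t\<^sup>2) * (x * (x + 1)) = (t\<^sup>2 + t) * x\<^sup>2 + (s\<^sup>2 + t) * x\<^sup>2 + (s\<^sup>2 + t\<^sup>2) * x"
      by (simp add: algebra_simps power2_eq_square c2)
    also have "\<dots> = 0" using r1 unfolding \<open>y = x\<close> .
    finally have "x * (x + 1) = 0" using st' mult_eq_0_iff by blast
    then show ?thesis unfolding mult_eq_0_iff char2_add_eq_0_iff[OF ch] by blast
  next
    case 2
    then have "x + y = s + t" by (simp only: char2_add_eq_0_iff[OF ch])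
    then have "y = x + (s + t)" using c2(2)[of x y] by simp
    have "(s\<^sup>2 + t\<^sup>2) * ((x + t) * (x + t + 1)) =
        (t\<^sup>2 + t) * (x + (s + t))\<^sup>2 + (s\<^sup>2 + t) * x\<^sup>2 + (s\<^sup>2 + t\<^sup>2) * x"
      by (simp add: algebra_simps power2_eq_square c2)
    also have "\<dots> = 0" using r1 unfolding \<open>y = x + (s + t)\<close> .
    finally have "(x + t) * (x + t + 1) = 0" using st' mult_eq_0_iff by blast
    then show ?thesis unfolding mult_eq_0_iff add.assoc char2_add_eq_0_iff[OF ch] by blast
  qed
qed

text \<open>Since \<open>\<sigma>\<close> applied twice is squaring, the image of the equation under
  \<open>\<sigma>\<close> again involves only \<open>x\<close> and \<open>y = \<sigma> x\<close>.
  Eliminating \<open>y\<close> leaves a quartic in \<open>x\<close> that is a nonzero multiple of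
  the product over the four points.\<close>

lemma linearized_roots_odd:
  fixes \<sigma> :: "'a::finite_field \<Rightarrow> 'a"
  assumes ch: "CHAR('a) = 2"
    and add: "\<And>x y. \<sigma> (x + y) = \<sigma> x + \<sigma> y" and mult: "\<And>x y. \<sigma> (x * y) = \<sigma> x * \<sigma> y"
    and sq: "\<And>x. \<sigma> (\<sigma> x) = x\<^sup>2" and t: "t \<noteq> 0" "t \<noteq> 1" and neq: "\<sigma> t \<noteq> t\<^sup>2"
    and root: "(t\<^sup>2 + t) * \<sigma> x + (\<sigma> t + t) * x\<^sup>2 + (\<sigma> t + t\<^sup>2) * x = 0"
  shows "x \<in> {0, 1, t, t + 1}"
proof -
  note c2 = char2_simps[OF ch]
  define s where "s = \<sigma> t"
  define y where "y = \<sigma> x"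
  define d where "d = t\<^sup>2 + t"
  define e where "e = s + t"
  define f where "f = s + t\<^sup>2"
  have f0: "f \<noteq> 0" using neq by (simp add: f_def s_def char2_add_eq_0_iff[OF ch])
  have e0: "e \<noteq> 0"
  proof
    assume "e = 0"
    then have "\<sigma> t = t" by (simp add: e_def s_def char2_add_eq_0_iff[OF ch])
    then have "t\<^sup>2 = t" using sq[of t] by simp
    then show False using t by (simp add: power2_eq_square)
  qed
  have "d * y + (e * x\<^sup>2 + f * x) = 0"
    using root by (simp add: d_def e_def f_def s_def y_def add.assoc)
  then have r1: "d * y = e * x\<^sup>2 + f * x" by (simp add: char2_add_eq_0_iff[OF ch])
  have "\<sigma> 0 = 0" using add[of 0 0] by (simp only: add_0_right add_cancel_right_right)
  have "\<sigma> ((t\<^sup>2 + t) * \<sigma> x + (\<sigma> t + t) * x\<^sup>2 + (\<sigma> t + t\<^sup>2) * x) = 0"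
    unfolding root by (rule \<open>\<sigma> 0 = 0\<close>)
  then have r2: "(s\<^sup>2 + s) * x\<^sup>2 + f * y\<^sup>2 + e\<^sup>2 * y = 0"
    by (simp add: add mult sq power2_eq_square s_def y_def f_def e_def algebra_simps c2)
  \<comment> \<open>The right side is \<open>d^2\<close> times \<open>r2\<close> with
    \<open>d * y\<close> replaced by means of \<open>r1\<close>, which avoids dividing by
    \<open>d\<close>. The factorization rests on \<open>d = e + f\<close>.\<close>
  have "f * e\<^sup>2 * (x * (x + t) * (x + 1) * (x + t + 1)) =
      d\<^sup>2 * ((s\<^sup>2 + s) * x\<^sup>2) + f * (e * x\<^sup>2 + f * x)\<^sup>2 + e\<^sup>2 * d * (e * x\<^sup>2 + f * x)"
    unfolding d_def e_def f_def by (simp add: algebra_simps power2_eq_square c2)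
  also have "\<dots> = d\<^sup>2 * ((s\<^sup>2 + s) * x\<^sup>2 + f * y\<^sup>2 + e\<^sup>2 * y)"
    unfolding r1[symmetric] by (simp add: algebra_simps power2_eq_square)
  also have "\<dots> = 0" by (simp add: r2)
  finally show ?thesis unfolding span_iff_product_eq_0[OF ch] using e0 f0 by simp
qed

section \<open>The subfield and the evaluation of the table\<close>

text \<open>Every element of a subfield with \<open>2 ^ m\<close> elements is a fixed point of this
  power map, and the two sets have equal size. Membership of \<open>a / b\<close> thus becomes an
  equation.\<close>

lemma subfield_of_order_eq_fixed:
  assumes "card (UNIV :: 'a::finite_field set) = 2 ^ (2 * m)" "m > 0"
  shows "subfield_of_order (2 ^ m) = {x::'a. x ^ 2 ^ m = x}"
proof (rule card_subset_eq)
  show "subfield_of_order (2 ^ m) \<subseteq> {x::'a. x ^ 2 ^ m = x}"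
    using subfield_of_order_props[OF assms] subfield_power_card by fastforce
  show "card (subfield_of_order (2 ^ m) :: 'a set) = card {x::'a. x ^ 2 ^ m = x}"
    by (simp add: subfield_of_order_props[OF assms] card_frobenius_fixed[OF assms])
qed simp

theorem theorem2:
  fixes m n :: nat and F :: "'a::finite_field \<Rightarrow> 'a" and a b :: 'a
  assumes "m > 0"
    and "n \<in> {2 * m, 2 * m + 1}"
    and "card (UNIV :: 'a set) = 2 ^ n"
    and "F = (\<lambda>x. x ^ (2 ^ (m + 1) - 1))"
  shows "(n = 2 * m \<longrightarrow>
            (a * b * (a + b) = 0 \<longrightarrow> FBCT F a b = 2 ^ n) \<and>
            (a * b * (a + b) \<noteq> 0 \<and> a / b \<in> subfield_of_order (2 ^ m) - {0, 1}
              \<longrightarrow> FBCT F a b = 2 ^ m) \<and>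
            (a * b * (a + b) \<noteq> 0 \<and> a / b \<in> UNIV - subfield_of_order (2 ^ m)
              \<longrightarrow> FBCT F a b = 0)) \<and>
         (n = 2 * m + 1 \<longrightarrow>
            (a * b * (a + b) = 0 \<longrightarrow> FBCT F a b = 2 ^ n) \<and>
            (a * b * (a + b) \<noteq> 0 \<longrightarrow> FBCT F a b = 0))"
proof -
  have ch: "CHAR('a) = 2" using assms(3) by (rule CHAR_eq_2)
  define \<phi> where "\<phi> = (\<lambda>x::'a. x ^ 2 ^ m)"
  define \<sigma> where "\<sigma> = (\<lambda>x::'a. x ^ 2 ^ (m + 1))"
  define t where "t = a / b"
  have \<sigma>_\<phi>: "\<sigma> x = (\<phi> x)\<^sup>2" for x
    by (simp add: \<sigma>_def \<phi>_def mult.commute flip: power_mult)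
  have \<phi>_add: "\<phi> (x + y) = \<phi> x + \<phi> y" for x y by (simp add: \<phi>_def char2_power_add[OF ch])
  have \<phi>_mult: "\<phi> (x * y) = \<phi> x * \<phi> y" for x y by (simp add: \<phi>_def power_mult_distrib)
  have \<sigma>_add: "\<sigma> (x + y) = \<sigma> x + \<sigma> y" for x y unfolding \<sigma>_def by (rule char2_power_add[OF ch])
  have \<sigma>_mult: "\<sigma> (x * y) = \<sigma> x * \<sigma> y" for x y unfolding \<sigma>_def by (rule power_mult_distrib)
  have \<sigma>_1: "\<sigma> 1 = 1" by (simp add: \<sigma>_def)
  have F_\<sigma>: "x * F x = \<sigma> x" for x
    by (simp add: assms(4) \<sigma>_def flip: power_Suc)
  \<comment> \<open>The exponent has to be positive, because \<open>0 ^ 0 = 1\<close>.\<close>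
  have F0: "F 0 = 0" using one_less_power[of "2::nat" "m + 1"] by (simp add: assms(4))
  have \<sigma>_eq_iff: "\<sigma> x = x\<^sup>2 \<longleftrightarrow> \<phi> x = x" for x by (simp add: \<sigma>_\<phi> char2_power2_eq_iff[OF ch])
  have trivial: "FBCT F a b = 2 ^ n" if "a * b * (a + b) = 0"
    using FBCT_trivial[OF ch that] assms(3) by simp
  note zero_iff = second_difference_zero_iff[OF ch F_\<sigma> \<sigma>_add \<sigma>_1]
  note on_span = second_difference_zero_on_span[OF ch F_\<sigma> \<sigma>_add \<sigma>_1 F0]
  have fbct: "FBCT F a b = card {x. second_difference F t 1 x = 0}"
    and t: "t \<noteq> 0" "t \<noteq> 1" if "a * b * (a + b) \<noteq> 0"
  proof -
    have "b \<noteq> 0" using that by auto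
    then show "FBCT F a b = card {x. second_difference F t 1 x = 0}"
      using FBCT_power_scale[of b _ a]
      by (simp add: assms(4) t_def FBCT_def second_difference_def)
    show "t \<noteq> 0" "t \<noteq> 1"
      using that by (auto simp: t_def char2_add_eq_0_iff[OF ch])
  qed
  \<comment> \<open>Common conclusion of both parities: \<open>\<phi> t \<noteq> t\<close> rules out
    the four special points, and \<open>roots\<close> rules out all others.\<close>
  have no_solution: "FBCT F a b = 0"
    if nz: "a * b * (a + b) \<noteq> 0" and neq: "\<phi> t \<noteq> t"
      and roots: "\<And>x. (t\<^sup>2 + t) * \<sigma> x + (\<sigma> t + t) * x\<^sup>2 + (\<sigma> t + t\<^sup>2) * x = 0 \<Longrightarrow> x \<in> {0, 1, t, t + 1}"
  proof -
    have "second_difference F t 1 x \<noteq> 0" for x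
      using on_span[OF t[OF nz], of x] zero_iff[of x t] roots[of x] neq \<sigma>_eq_iff[of t] by blast
    then show ?thesis by (simp add: fbct[OF nz])
  qed
  have even: "FBCT F a b = (if t \<in> subfield_of_order (2 ^ m) then 2 ^ m else 0)"
    if n: "n = 2 * m" and nz: "a * b * (a + b) \<noteq> 0"
  proof -
    have card: "card (UNIV :: 'a set) = 2 ^ (2 * m)" using assms(3) n by simp
    have sub: "subfield_of_order (2 ^ m) = {x. \<phi> x = x}"
      unfolding \<phi>_def by (rule subfield_of_order_eq_fixed[OF card assms(1)])
    have invol: "\<phi> (\<phi> x) = x" for x
      using finite_field_power_card_eq_same[of x]
      by (simp add: \<phi>_def card mult_2 power_add flip: power_mult)
    show ?thesis
    proof (cases "\<phi> t = t")
      case True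
      then have \<sigma>t: "\<sigma> t = t\<^sup>2" by (simp add: \<sigma>_eq_iff)
      \<comment> \<open>The zeros are exactly the subfield: it contains the four special points, and
        elsewhere the equation reduces to \<open>\<sigma> x = x^2\<close>.\<close>
      have "second_difference F t 1 x = 0 \<longleftrightarrow> \<phi> x = x" for x
      proof (cases "x \<in> {0, 1, t, t + 1}")
        case x: True
        have "\<phi> 0 = 0" "\<phi> 1 = 1" by (simp_all add: \<phi>_def)
        then have "\<phi> x = x" using x \<phi>_add True by auto
        then show ?thesis using on_span[OF t[OF nz] x] \<sigma>t by blast
      next
        case False
        have "t\<^sup>2 + t \<noteq> 0"
          using t[OF nz] by (simp add: char2_add_eq_0_iff[OF ch] power2_eq_square)
        have "second_difference F t 1 x = 0 \<longleftrightarrow> (t\<^sup>2 + t) * (\<sigma> x + x\<^sup>2) = 0"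
          unfolding zero_iff[OF False] \<sigma>t by (simp add: distrib_left char2_simps[OF ch])
        also have "\<dots> \<longleftrightarrow> \<phi> x = x"
          using \<open>t\<^sup>2 + t \<noteq> 0\<close> \<sigma>_eq_iff by (simp add: char2_add_eq_0_iff[OF ch])
        finally show ?thesis .
      qed
      then show ?thesis
        using True card_frobenius_fixed[OF card assms(1)] by (simp add: fbct[OF nz] sub \<phi>_def)
    next
      case False
      have "FBCT F a b = 0"
        using no_solution[OF nz False] linearized_roots_even[OF ch \<phi>_add \<phi>_mult invol False]
        unfolding \<sigma>_\<phi> by blast
      then show ?thesis using False by (simp add: sub)
    qed
  qed
  have odd: "FBCT F a b = 0" if n: "n = 2 * m + 1" and nz: "a * b * (a + b) \<noteq> 0"
  proof -
    \<comment> \<open>The exponent of \<open>\<sigma>\<close> applied twice is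
      \<open>2 ^ (2 * m + 2)\<close>, one doubling more than the field size, which leaves
      squaring.\<close>
    have "(2::nat) ^ (m + 1) * 2 ^ (m + 1) = 2 ^ n * 2" by (simp only: n flip: power_add power_Suc2) simp
    then have \<sigma>_sq: "\<sigma> (\<sigma> x) = x\<^sup>2" for x
      unfolding \<sigma>_def power_mult[symmetric]
      using finite_field_power_card_eq_same[of x] assms(3) by (simp only: power_mult)
    \<comment> \<open>A fixed point would satisfy both \<open>\<sigma> (\<sigma> t) = t^4\<close>
      and \<open>\<sigma> (\<sigma> t) = t^2\<close>, hence lie in \<open>{0, 1}\<close>.\<close>
    have "\<phi> t \<noteq> t"
    proof
      assume "\<phi> t = t"
      then have "\<sigma> (\<sigma> t) = (t\<^sup>2)\<^sup>2" by (simp add: \<sigma>_\<phi> \<phi>_mult power2_eq_square)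
      then have "t = t\<^sup>2" unfolding \<sigma>_sq char2_power2_eq_iff[OF ch] .
      then show False using t[OF nz] by (simp add: power2_eq_square)
    qed
    moreover from this have "\<sigma> t \<noteq> t\<^sup>2" by (simp add: \<sigma>_eq_iff)
    ultimately show ?thesis
      using no_solution[OF nz] linearized_roots_odd[OF ch \<sigma>_add \<sigma>_mult \<sigma>_sq t[OF nz]] by blast
  qed
  show ?thesis
    using trivial even odd by (simp add: t_def)
qed

end
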